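(* Let $A_3$ be the 2-state Mealy automaton over the 4-symbol alphabet $\{x_0,x_1,x_2,x_3\}$ whose automatic transformations have the unrolled forms $$f_0=(f_0,f_0,f_0,f_0)(x_1,x_2,x_2,x_2),\qquad f_1=(f_0,f_1,f_1,f_1)(x_3,x_0,x_2,x_2).$$ Then: (1) The semigroup $S_{A_3}$ generated by $f_0,f_1$ has the semigroup presentation with generators $f_0,f_1$ and defining relations $$f_0^2f_i=f_1f_0^2=f_0^2\ (i=0,1),\qquad f_0f_1f_0=f_0,\qquad f_0f_1^2f_0=f_0^2,\qquad f_1^3f_0f_1=f_1f_0f_1^3 .$$ (2) The growth function $\gamma_{A_3}$ of $A_3$ is a composite function for $k=2$, given by $$\gamma_{A_3}(2n)=4n,\qquad \gamma_{A_3}(2n+1)=5n+1\qquad\text{for all } n\ge 1,$$ and $\gamma_{A_3}(1)=2$.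
   Context: A Mealy automaton with states $q_0,\dots,q_{n-1}$ and input/output alphabet $X_m=\{x_0,\dots,x_{m-1}\}$ has a transition function $\pi:X_m\times Q\to Q$ and an output function $\lambda:X_m\times Q\to X_m$. The state $q_i$ defines an automatic transformation $f_i=f_{q_i}$ of the set of finite (or infinite) words over $X_m$: on input $x u$ ($x$ a letter) it outputs $\lambda(x,q_i)$ followed by $f_{\pi(x,q_i)}(u)$. The unrolled form $f_i=(g_0,\dots,g_{m-1})(y_0,\dots,y_{m-1})$ means $f_i(x_ju)=y_j\,g_j(u)$ for every letter $x_j$ and word $u$. Products of transformations are compositions applied from right to left: $(fg)(u)=f(g(u))$. $S_A$ is the semigroup generated by the automatic transformations $f_0,\dots,f_{n-1}$ under composition. The growth function of $A$ is $\gamma_A(n)=|Q_{A^{(n)}}|$, the number of states of the minimal automaton equivalent to the $n$-th power $A^n$ (sequential application); equivalently, for $n\ge1$, $\gamma_A(n)$ is the number of distinct transformations of the form $f_{i_1}f_{i_2}\cdots f_{i_n}$ (products of exactly $n$ generators). A function $\gamma$ is called composite for $k\geq 2$ if at least two of the functions $n\mapsto\gamma(kn+i)$, $0\le i<k$, are given by different expressions; for $k=2$ here this is witnessed by the two displayed formulas for even and odd arguments. *)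

theory Defs
  imports Complex_Main
begin

section \<open>Mealy automata\<close>

text \<open>The alphabet is the (finite) type of letters, used both for input and output; the states
  form an explicit set, since powers and minimal automata have derived state sets.\<close>

record ('q, 'x) mealy =
  states :: "'q set"
  trans :: "'x \<Rightarrow> 'q \<Rightarrow> 'q"
  out :: "'x \<Rightarrow> 'q \<Rightarrow> 'x"

definition mealy_automaton :: "('q, 'x :: finite) mealy \<Rightarrow> bool" where
  "mealy_automaton A \<longleftrightarrow> finite (states A) \<and> states A \<noteq> {} \<and>
     (\<forall>x. \<forall>q\<in>states A. trans A x q \<in> states A)"

fun transf :: "('q, 'x) mealy \<Rightarrow> 'q \<Rightarrow> 'x list \<Rightarrow> 'x list" where
  "transf A q [] = []"
| "transf A q (x # u) = out A x q # transf A (trans A x q) u"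

inductive_set automaton_semigroup :: "('q, 'x) mealy \<Rightarrow> ('x list \<Rightarrow> 'x list) set"
  for A :: "('q, 'x) mealy" where
  gen: "q \<in> states A \<Longrightarrow> transf A q \<in> automaton_semigroup A"
| mult: "f \<in> automaton_semigroup A \<Longrightarrow> g \<in> automaton_semigroup A \<Longrightarrow> f \<circ> g \<in> automaton_semigroup A"

section \<open>Powers, minimal automata and growth\<close>

text \<open>A state of the \<open>n\<close>-th power is a list of \<open>n\<close> states. Since products act from right to left,
  the last state in the list reads the input and the first one writes the output.\<close>

fun pow_output :: "('q, 'x) mealy \<Rightarrow> 'x \<Rightarrow> 'q list \<Rightarrow> 'x" where
  "pow_output A x [] = x"
| "pow_output A x (q # w) = out A (pow_output A x w) q"

fun pow_trans :: "('q, 'x) mealy \<Rightarrow> 'x \<Rightarrow> 'q list \<Rightarrow> 'q list" where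
  "pow_trans A x [] = []"
| "pow_trans A x (q # w) = trans A (pow_output A x w) q # pow_trans A x w"

definition mealy_power :: "('q, 'x) mealy \<Rightarrow> nat \<Rightarrow> ('q list, 'x) mealy" where
  "mealy_power A n = \<lparr>states = {w. set w \<subseteq> states A \<and> length w = n},
     trans = pow_trans A, out = pow_output A\<rparr>"

definition state_equiv :: "('q, 'x) mealy \<Rightarrow> ('q \<times> 'q) set" where
  "state_equiv A = {(p, q). p \<in> states A \<and> q \<in> states A \<and> transf A p = transf A q}"

definition mealy_equivalent :: "('p, 'x) mealy \<Rightarrow> ('q, 'x) mealy \<Rightarrow> bool" where
  "mealy_equivalent A B \<longleftrightarrow> transf A ` states A = transf B ` states B"

text \<open>The minimal automaton identifies equivalent states. The representative chosen by
  \<open>SOME\<close> is irrelevant; see \<open>trans_minimal\<close> and \<open>output_minimal\<close> below.\<close>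

definition minimal_mealy :: "('q, 'x) mealy \<Rightarrow> ('q set, 'x) mealy" where
  "minimal_mealy A = \<lparr>states = states A // state_equiv A,
     trans = (\<lambda>x C. state_equiv A `` {trans A x (SOME q. q \<in> C)}),
     out = (\<lambda>x C. out A x (SOME q. q \<in> C))\<rparr>"

definition growth :: "('q, 'x) mealy \<Rightarrow> nat \<Rightarrow> nat" where
  "growth A n = card (states (minimal_mealy (mealy_power A n)))"

text \<open>"Given by different expressions" is read as: differing for arbitrarily large arguments,
  so that finitely many exceptional values do not count.\<close>

definition composite_function :: "nat \<Rightarrow> (nat \<Rightarrow> nat) \<Rightarrow> bool" where
  "composite_function k \<gamma> \<longleftrightarrow> k \<ge> 2 \<and>
     (\<exists>i<k. \<exists>j<k. \<not> (\<forall>\<^sub>F n in sequentially. \<gamma> (k * n + i) = \<gamma> (k * n + j)))"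

lemma equiv_state_equiv: "equiv (states A) (state_equiv A)"
  by (auto simp: equiv_def refl_on_def sym_def Relation.trans_def state_equiv_def)

lemma state_equiv_step:
  assumes "mealy_automaton A" "(p, q) \<in> state_equiv A"
  shows "out A x p = out A x q" "(trans A x p, trans A x q) \<in> state_equiv A"
proof -
  have *: "transf A p (x # u) = transf A q (x # u)" for u
    using assms by (simp add: state_equiv_def)
  from *[of "[]"] show "out A x p = out A x q" by simp
  have "transf A (trans A x p) = transf A (trans A x q)"
    using * by auto
  with assms show "(trans A x p, trans A x q) \<in> state_equiv A"
    by (auto simp: state_equiv_def mealy_automaton_def)
qed

lemma some_class:
  assumes "q \<in> states A"
  shows "(q, SOME p. p \<in> state_equiv A `` {q}) \<in> state_equiv A"
proof -
  have "q \<in> state_equiv A `` {q}"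
    using assms by (simp add: state_equiv_def)
  then have "(SOME p. p \<in> state_equiv A `` {q}) \<in> state_equiv A `` {q}"
    by (rule someI)
  then show ?thesis by simp
qed

lemma output_minimal:
  assumes "mealy_automaton A" "q \<in> states A"
  shows "out (minimal_mealy A) x (state_equiv A `` {q}) = out A x q"
  using state_equiv_step(1)[OF assms(1) some_class[OF assms(2)]]
  by (simp add: minimal_mealy_def)

lemma trans_minimal:
  assumes "mealy_automaton A" "q \<in> states A"
  shows "trans (minimal_mealy A) x (state_equiv A `` {q}) = state_equiv A `` {trans A x q}"
  using equiv_class_eq[OF equiv_state_equiv state_equiv_step(2)[OF assms(1) some_class[OF assms(2)]]]
  by (simp add: minimal_mealy_def)

lemma transf_minimal:
  assumes "mealy_automaton A" "q \<in> states A"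
  shows "transf (minimal_mealy A) (state_equiv A `` {q}) u = transf A q u"
  using assms(2)
proof (induction u arbitrary: q)
  case (Cons x u)
  then have "trans A x q \<in> states A"
    using assms(1) by (auto simp: mealy_automaton_def)
  with Cons show ?case
    by (simp add: output_minimal trans_minimal assms(1))
qed simp

lemma states_minimal:
  "states (minimal_mealy A) = (\<lambda>q. state_equiv A `` {q}) ` states A"
  by (auto simp: minimal_mealy_def quotient_def)

lemma mealy_automaton_minimal:
  assumes "mealy_automaton A"
  shows "mealy_automaton (minimal_mealy A)"
  using assms by (auto simp: mealy_automaton_def states_minimal trans_minimal[OF assms])

lemma minimal_equivalent:
  assumes "mealy_automaton A"
  shows "mealy_equivalent (minimal_mealy A) A"
proof -
  have "transf (minimal_mealy A) (state_equiv A `` {q}) = transf A q" if "q \<in> states A" for q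
    using transf_minimal[OF assms that] by blast
  then show ?thesis
    by (simp add: mealy_equivalent_def states_minimal image_image)
qed

lemma card_states_minimal:
  "card (states (minimal_mealy A)) = card (transf A ` states A)"
proof -
  have "bij_betw (\<lambda>C. transf A (SOME q. q \<in> C)) (states (minimal_mealy A)) (transf A ` states A)"
  proof -
    have *: "transf A (SOME p. p \<in> state_equiv A `` {q}) = transf A q" if "q \<in> states A" for q
    proof -
      have "(p, p') \<in> state_equiv A \<Longrightarrow> transf A p' = transf A p" for p p'
        by (simp add: state_equiv_def)
      from this[OF some_class[OF that]] show ?thesis .
    qed
    have "inj_on (\<lambda>C. transf A (SOME q. q \<in> C)) (states (minimal_mealy A))"
    proof (rule inj_onI, unfold states_minimal, elim imageE, hypsubst)
      fix p q
      assume "p \<in> states A" "q \<in> states A"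
        and "transf A (SOME r. r \<in> state_equiv A `` {p}) = transf A (SOME r. r \<in> state_equiv A `` {q})"
      then have "(p, q) \<in> state_equiv A"
        using *[of p] *[of q] by (simp only:) (simp add: state_equiv_def)
      then show "state_equiv A `` {p} = state_equiv A `` {q}"
        by (rule equiv_class_eq[OF equiv_state_equiv])
    qed
    moreover have "(\<lambda>C. transf A (SOME q. q \<in> C)) ` states (minimal_mealy A) = transf A ` states A"
      using * by (simp add: states_minimal image_image)
    ultimately show ?thesis by (simp add: bij_betw_def)
  qed
  then show ?thesis by (rule bij_betw_same_card)
qed

lemma minimal_least:
  assumes "mealy_automaton B" "mealy_equivalent B A"
  shows "card (states (minimal_mealy A)) \<le> card (states B)"
  using assms card_image_le[of "states B" "transf B"]
  by (simp add: card_states_minimal mealy_equivalent_def mealy_automaton_def)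

lemma transf_power: "transf (mealy_power A n) w = foldr (\<lambda>q g. transf A q \<circ> g) w id"
proof -
  have power_Nil: "transf (mealy_power A n) [] u = u" for u
    by (induction u) (simp_all add: mealy_power_def)
  have power_Cons: "transf (mealy_power A n) (q # w) u = transf A q (transf (mealy_power A n) w u)"
    for q w u
    by (induction u arbitrary: q w) (simp_all add: mealy_power_def)
  show ?thesis
    by (induction w) (auto simp: power_Nil power_Cons fun_eq_iff)
qed

lemma growth_eq_card_products:
  "growth A n = card ((\<lambda>w. foldr (\<lambda>q g. transf A q \<circ> g) w id) ` {w. set w \<subseteq> states A \<and> length w = n})"
  by (simp add: growth_def card_states_minimal transf_power) (simp add: mealy_power_def)

section \<open>Semigroup presentations\<close>

definition free_semigroup :: "'g set \<Rightarrow> 'g list set" where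
  "free_semigroup G = {w. w \<noteq> [] \<and> set w \<subseteq> G}"

definition free_congruence :: "'g set \<Rightarrow> ('g list \<times> 'g list) set \<Rightarrow> bool" where
  "free_congruence G r \<longleftrightarrow> equiv (free_semigroup G) r \<and>
     (\<forall>(u, v)\<in>r. \<forall>w\<in>free_semigroup G. (w @ u, w @ v) \<in> r \<and> (u @ w, v @ w) \<in> r)"

definition generated_congruence ::
    "'g set \<Rightarrow> ('g list \<times> 'g list) set \<Rightarrow> ('g list \<times> 'g list) set" where
  "generated_congruence G R = \<Inter>{r. free_congruence G r \<and> R \<subseteq> r}"

text \<open>The semigroup \<open>(S, mult)\<close> has the presentation \<open>\<langle>G | R\<rangle>\<close>, a generator \<open>g\<close> being interpreted
  as the element \<open>\<iota> g\<close> of \<open>S\<close>.\<close>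

definition has_semigroup_presentation ::
    "'a set \<Rightarrow> ('a \<Rightarrow> 'a \<Rightarrow> 'a) \<Rightarrow> 'g set \<Rightarrow> ('g \<Rightarrow> 'a) \<Rightarrow> ('g list \<times> 'g list) set \<Rightarrow> bool" where
  "has_semigroup_presentation S mult G \<iota> R \<longleftrightarrow>
     R \<subseteq> free_semigroup G \<times> free_semigroup G \<and>
     (let c = generated_congruence G R in
      \<exists>\<phi>. bij_betw \<phi> (free_semigroup G // c) S \<and>
        (\<forall>u\<in>free_semigroup G. \<forall>v\<in>free_semigroup G.
           \<phi> (c `` {u @ v}) = mult (\<phi> (c `` {u})) (\<phi> (c `` {v}))) \<and>
        (\<forall>g\<in>G. \<phi> (c `` {[g]}) = \<iota> g))"

section \<open>The automaton\<close>

datatype letter = x0 | x1 | x2 | x3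

datatype state = q0 | q1

lemma UNIV_letter: "UNIV = {x0, x1, x2, x3}"
  using letter.exhaust by auto

instance letter :: finite
  by standard (simp add: UNIV_letter)

fun A3_trans :: "letter \<Rightarrow> state \<Rightarrow> state" where
  "A3_trans x0 q0 = q0" | "A3_trans x1 q0 = q0" | "A3_trans x2 q0 = q0" | "A3_trans x3 q0 = q0"
| "A3_trans x0 q1 = q0" | "A3_trans x1 q1 = q1" | "A3_trans x2 q1 = q1" | "A3_trans x3 q1 = q1"

fun A3_output :: "letter \<Rightarrow> state \<Rightarrow> letter" where
  "A3_output x0 q0 = x1" | "A3_output x1 q0 = x2" | "A3_output x2 q0 = x2" | "A3_output x3 q0 = x2"
| "A3_output x0 q1 = x3" | "A3_output x1 q1 = x0" | "A3_output x2 q1 = x2" | "A3_output x3 q1 = x2"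

definition A3 :: "(state, letter) mealy" where
  "A3 = \<lparr>states = {q0, q1}, trans = A3_trans, out = A3_output\<rparr>"

lemma mealy_automaton_A3: "mealy_automaton A3"
  unfolding mealy_automaton_def
proof (intro conjI allI ballI)
  show "trans A3 x q \<in> states A3" for x q
    by (cases "trans A3 x q") (simp_all add: A3_def)
qed (simp_all add: A3_def)

lemma A3_unrolled:
  "transf A3 q0 (x0 # u) = x1 # transf A3 q0 u"
  "transf A3 q0 (x1 # u) = x2 # transf A3 q0 u"
  "transf A3 q0 (x2 # u) = x2 # transf A3 q0 u"
  "transf A3 q0 (x3 # u) = x2 # transf A3 q0 u"
  "transf A3 q1 (x0 # u) = x3 # transf A3 q0 u"
  "transf A3 q1 (x1 # u) = x0 # transf A3 q1 u"
  "transf A3 q1 (x2 # u) = x2 # transf A3 q1 u"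
  "transf A3 q1 (x3 # u) = x2 # transf A3 q1 u"
  by (simp_all add: A3_def)

end

theory Submission
  imports Defs
begin

text \<open>The relations make \<open>f\<^sub>0\<^sup>2\<close> a zero, erase \<open>f\<^sub>1f\<^sub>0\<close> after \<open>f\<^sub>0\<close>, and let even powers of
  \<open>f\<^sub>1\<close> cross an \<open>f\<^sub>0\<close> that stands between two \<open>f\<^sub>1\<close>, so every word reduces to one of the powers of \<open>f\<^sub>1\<close>, the zero, or a
  word with at most two occurrences of \<open>f\<^sub>0\<close>. These normal forms are told apart by their values on the
  words \<open>x\<^sub>1\<^sup>k\<close>, \<open>x\<^sub>0\<^sup>k\<close> and \<open>x\<^sub>1x\<^sub>0\<^sup>k\<close>: the images stay in a small family of words
  of the form \<open>x\<^sub>2\<^sup>m\<close> followed by a simple tail. Hence the relations are complete,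
  and the growth function counts the normal forms of the products of \<open>n\<close> generators.\<close>

section \<open>Presentations from kernels\<close>

text \<open>Keeps the family intersected in \<open>generated_congruence\<close> nonempty, so that
  the intersection is a relation on the free semigroup.\<close>

lemma free_congruence_full: "free_congruence G (free_semigroup G \<times> free_semigroup G)"
  by (auto simp: free_congruence_def equiv_def refl_on_def sym_def Relation.trans_def free_semigroup_def)

lemma free_congruence_generated:
  assumes "R \<subseteq> free_semigroup G \<times> free_semigroup G"
  shows "free_congruence G (generated_congruence G R)"
proof -
  let ?C = "{r. free_congruence G r \<and> R \<subseteq> r}"
  have full: "free_semigroup G \<times> free_semigroup G \<in> ?C"
    using assms free_congruence_full by blast
  have "equiv (free_semigroup G) r" if "r \<in> ?C" for r
    using that by (simp add: free_congruence_def)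
  then have sub: "\<Inter>?C \<subseteq> free_semigroup G \<times> free_semigroup G"
    and refl: "\<forall>r\<in>?C. \<forall>x\<in>free_semigroup G. (x, x) \<in> r"
    and sym: "\<forall>r\<in>?C. sym r" and trans: "\<forall>r\<in>?C. Relation.trans r"
    using full by (auto simp: equiv_def refl_on_def)
  have "equiv (free_semigroup G) (\<Inter>?C)"
    unfolding equiv_def
  proof (intro conjI)
    show "\<Inter>?C \<subseteq> free_semigroup G \<times> free_semigroup G" by (fact sub)
    show "refl_on (free_semigroup G) (\<Inter>?C)"
      using refl sub unfolding refl_on_def by blast
    show "sym (\<Inter>?C)"
      using sym unfolding sym_def by blast
    show "Relation.trans (\<Inter>?C)"
      using trans unfolding Relation.trans_def by blast
  qed
  moreover have "(w @ u, w @ v) \<in> \<Inter>?C \<and> (u @ w, v @ w) \<in> \<Inter>?C"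
    if "(u, v) \<in> \<Inter>?C" "w \<in> free_semigroup G" for u v w
    using that unfolding free_congruence_def by blast
  ultimately show ?thesis
    unfolding free_congruence_def generated_congruence_def by blast
qed

lemma generated_congruence_least:
  "free_congruence G r \<Longrightarrow> R \<subseteq> r \<Longrightarrow> generated_congruence G R \<subseteq> r"
  by (auto simp: generated_congruence_def)

lemma generated_congruence_base: "R \<subseteq> generated_congruence G R"
  by (auto simp: generated_congruence_def)

text \<open>The kernel of \<open>h\<close> is a congruence containing \<open>R\<close>, so it
  contains the least one.\<close>

lemma generated_congruence_sound:
  assumes hom: "\<And>u v. u \<in> free_semigroup G \<Longrightarrow> v \<in> free_semigroup G \<Longrightarrow> h (u @ v) = mult (h u) (h v)"
    and R: "R \<subseteq> free_semigroup G \<times> free_semigroup G" "\<And>u v. (u, v) \<in> R \<Longrightarrow> h u = h v"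
    and uv: "(u, v) \<in> generated_congruence G R"
  shows "h u = h v"
proof -
  let ?K = "{(u, v). u \<in> free_semigroup G \<and> v \<in> free_semigroup G \<and> h u = h v}"
  have "equiv (free_semigroup G) ?K"
    by (auto simp: equiv_def refl_on_def sym_def Relation.trans_def)
  moreover have "u @ v \<in> free_semigroup G" if "u \<in> free_semigroup G" "v \<in> free_semigroup G" for u v
    using that by (auto simp: free_semigroup_def)
  ultimately have "free_congruence G ?K"
    by (auto simp: free_congruence_def hom)
  moreover have "R \<subseteq> ?K"
    using R by auto
  ultimately have "generated_congruence G R \<subseteq> ?K"
    by (rule generated_congruence_least)
  with uv show ?thesis by auto
qed

text \<open>Soundness makes \<open>h\<close> constant on congruence classes and completeness makes
  it separate them, so it descends to the required bijection.\<close>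

lemma has_semigroup_presentationI:
  assumes R: "R \<subseteq> free_semigroup G \<times> free_semigroup G"
    and hom: "\<And>u v. u \<in> free_semigroup G \<Longrightarrow> v \<in> free_semigroup G \<Longrightarrow> h (u @ v) = mult (h u) (h v)"
    and gens: "\<And>g. g \<in> G \<Longrightarrow> h [g] = \<iota> g"
    and surj: "h ` free_semigroup G = S"
    and sound: "\<And>u v. (u, v) \<in> R \<Longrightarrow> h u = h v"
    and complete: "\<And>u v. u \<in> free_semigroup G \<Longrightarrow> v \<in> free_semigroup G \<Longrightarrow> h u = h v
      \<Longrightarrow> (u, v) \<in> generated_congruence G R"
  shows "has_semigroup_presentation S mult G \<iota> R"
proof -
  let ?F = "free_semigroup G" and ?c = "generated_congruence G R"
  have eq: "equiv ?F ?c"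
    using free_congruence_generated[OF R] by (simp add: free_congruence_def)
  have ker: "(u, v) \<in> ?c \<Longrightarrow> h u = h v" for u v
    by (rule generated_congruence_sound[where h = h, OF hom R sound])
  define \<phi> where "\<phi> C = h (SOME u. u \<in> C)" for C
  have \<phi>: "\<phi> (?c `` {u}) = h u" if "u \<in> ?F" for u
  proof -
    have "u \<in> ?c `` {u}"
      using eq that by (rule equiv_class_self)
    then have "(SOME v. v \<in> ?c `` {u}) \<in> ?c `` {u}"
      by (rule someI)
    then show ?thesis
      using ker by (simp add: \<phi>_def)
  qed
  have "bij_betw \<phi> (?F // ?c) S"
    unfolding bij_betw_def
  proof
    show "inj_on \<phi> (?F // ?c)"
    proof (rule inj_onI)
      fix C D assume "C \<in> ?F // ?c" "D \<in> ?F // ?c" and CD: "\<phi> C = \<phi> D"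
      then obtain u v where u: "u \<in> ?F" "C = ?c `` {u}" and v: "v \<in> ?F" "D = ?c `` {v}"
        by (auto elim!: quotientE)
      with CD have "h u = h v"
        by (simp add: \<phi>)
      with u v complete show "C = D"
        using equiv_class_eq[OF eq] by simp
    qed
    have "\<phi> ` (?F // ?c) = h ` ?F"
      by (force simp: quotient_def \<phi> image_iff)
    with surj show "\<phi> ` (?F // ?c) = S" by simp
  qed
  moreover have "u @ v \<in> ?F" if "u \<in> ?F" "v \<in> ?F" for u v
    using that by (auto simp: free_semigroup_def)
  moreover have "[g] \<in> ?F" if "g \<in> G" for g
    using that by (simp add: free_semigroup_def)
  ultimately show ?thesis
    unfolding has_semigroup_presentation_def Let_def
    by (intro conjI R exI[of _ \<phi>]) (simp_all add: \<phi> hom gens)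
qed

lemma products_eq_automaton_semigroup:
  "(\<lambda>w. foldr (\<lambda>q g. transf A q \<circ> g) w id) ` free_semigroup (states A) = automaton_semigroup A"
  (is "?act ` _ = _")
proof (rule set_eqI, rule iffI)
  have app: "?act (u @ v) = ?act u \<circ> ?act v" for u v
    by (induction u) auto
  have closed: "?act w \<in> automaton_semigroup A" if "w \<noteq> []" "set w \<subseteq> states A" for w
    using that
  proof (induction w)
    case (Cons q w)
    then have q: "transf A q \<in> automaton_semigroup A"
      by (auto intro: automaton_semigroup.gen)
    show ?case
    proof (cases "w = []")
      case False
      then have "?act w \<in> automaton_semigroup A"
        by (rule Cons.IH) (use Cons.prems in simp)
      with q have "transf A q \<circ> ?act w \<in> automaton_semigroup A"
        by (rule automaton_semigroup.mult)
      moreover have "?act (q # w) = transf A q \<circ> ?act w"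
        by (rule ext) simp
      ultimately show ?thesis by (simp only:)
    qed (use q in simp)
  qed simp
  show "f \<in> automaton_semigroup A" if "f \<in> ?act ` free_semigroup (states A)" for f
    using that closed by (auto simp: free_semigroup_def)
  show "f \<in> ?act ` free_semigroup (states A)" if "f \<in> automaton_semigroup A" for f
    using that
  proof induction
    case (gen q)
    then show ?case
      by (intro image_eqI[of _ _ "[q]"]) (auto simp: free_semigroup_def)
  next
    case (mult f g)
    then obtain u v where "u \<in> free_semigroup (states A)" "f = ?act u"
      "v \<in> free_semigroup (states A)" "g = ?act v" by blast
    then have "u @ v \<in> free_semigroup (states A)" "f \<circ> g = ?act (u @ v)"
      by (simp_all only: app) (auto simp: free_semigroup_def)
    then show ?case
      by (intro image_eqI)
  qed
qed

section \<open>The transformations of the automaton\<close>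

abbreviation f0 :: "letter list \<Rightarrow> letter list" where "f0 \<equiv> transf A3 q0"
abbreviation f1 :: "letter list \<Rightarrow> letter list" where "f1 \<equiv> transf A3 q1"

definition act :: "state list \<Rightarrow> letter list \<Rightarrow> letter list" where
  "act w = foldr (\<lambda>q g. transf A3 q \<circ> g) w id"

lemma act_simps [simp]:
  "act [] u = u" "act (q # w) u = transf A3 q (act w u)"
  by (simp_all add: act_def)

lemma act_append [simp]: "act (v @ w) = act v \<circ> act w"
  by (induction v) (auto simp: fun_eq_iff)

declare transf.simps(2) [simp del]
declare A3_unrolled [simp]

lemma length_transf [simp]: "length (transf A q u) = length u"
  by (induction u arbitrary: q) (simp_all add: transf.simps(2))

lemma f_twos [simp]: "f0 (replicate k x2) = replicate k x2" "f1 (replicate k x2) = replicate k x2"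
  by (induction k) simp_all

lemma f0_f0 [simp]: "f0 (f0 u) = replicate (length u) x2"
proof (induction u)
  case (Cons x u)
  then show ?case by (cases x) simp_all
qed simp

lemma f0_f1_f0 [simp]: "f0 (f1 (f0 u)) = f0 u"
proof (induction u)
  case (Cons x u)
  then show ?case by (cases x) simp_all
qed simp

lemma f0_f1_f1_f0 [simp]: "f0 (f1 (f1 (f0 u))) = replicate (length u) x2"
proof (induction u)
  case (Cons x u)
  then show ?case by (cases x) simp_all
qed simp

lemma f1_cubed_f0_f1: "f1 (f1 (f1 (f0 (f1 u)))) = f1 (f0 (f1 (f1 (f1 u))))"
proof (induction u)
  case (Cons x u)
  then show ?case by (cases x) simp_all
qed simp

definition relators :: "(state list \<times> state list) set" where
  "relators = {([q0, q0, q0], [q0, q0]),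
            ([q0, q0, q1], [q0, q0]),
            ([q1, q0, q0], [q0, q0]),
            ([q0, q1, q0], [q0]),
            ([q0, q1, q1, q0], [q0, q0]),
            ([q1, q1, q1, q0, q1], [q1, q0, q1, q1, q1])}"

lemma act_relators: "(u, v) \<in> relators \<Longrightarrow> act u = act v"
  by (auto simp: relators_def fun_eq_iff f1_cubed_f0_f1)

section \<open>Consequences of the relations\<close>

lemma mem_free_semigroup [simp]: "w \<in> free_semigroup {q0, q1} \<longleftrightarrow> w \<noteq> []"
proof -
  have "q \<in> {q0, q1}" for q by (cases q) simp_all
  then show ?thesis by (auto simp: free_semigroup_def)
qed

lemma relators_free: "relators \<subseteq> free_semigroup {q0, q1} \<times> free_semigroup {q0, q1}"
  by (simp add: relators_def)

text \<open>Equality is added because the empty word lies outside the free semigroup; empty words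
  and contexts then need no separate treatment.\<close>

definition eqv :: "state list \<Rightarrow> state list \<Rightarrow> bool" (infix "\<approx>" 50) where
  "u \<approx> v \<longleftrightarrow> u = v \<or> (u, v) \<in> generated_congruence {q0, q1} relators"

lemma congruence: "free_congruence {q0, q1} (generated_congruence {q0, q1} relators)"
  by (rule free_congruence_generated[OF relators_free])

lemma eqv_refl [simp]: "u \<approx> u"
  by (simp add: eqv_def)

lemma eqv_sym: "u \<approx> v \<Longrightarrow> v \<approx> u"
  using congruence by (auto simp: eqv_def free_congruence_def equiv_def dest: symD)

lemma eqv_trans [trans]: "u \<approx> v \<Longrightarrow> v \<approx> w \<Longrightarrow> u \<approx> w"
  using congruence by (auto simp: eqv_def free_congruence_def equiv_def dest: transD)

lemma eqv_append_left: "u \<approx> v \<Longrightarrow> w @ u \<approx> w @ v"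
  using congruence by (cases "w = []") (auto simp: eqv_def free_congruence_def)

lemma eqv_append_right: "u \<approx> v \<Longrightarrow> u @ w \<approx> v @ w"
  using congruence by (cases "w = []") (auto simp: eqv_def free_congruence_def)

lemma eqv_Cons: "u \<approx> v \<Longrightarrow> q # u \<approx> q # v"
  using eqv_append_left[of u v "[q]"] by simp

lemma eqv_relator: "(u, v) \<in> relators \<Longrightarrow> u @ w \<approx> v @ w"
  by (rule eqv_append_right) (use generated_congruence_base in \<open>auto simp: eqv_def\<close>)

lemma eqv_relators:
  "q0 # q0 # q0 # w \<approx> q0 # q0 # w"
  "q0 # q0 # q1 # w \<approx> q0 # q0 # w"
  "q1 # q0 # q0 # w \<approx> q0 # q0 # w"
  "q0 # q1 # q0 # w \<approx> q0 # w"
  "q0 # q1 # q1 # q0 # w \<approx> q0 # q0 # w"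
  "q1 # q1 # q1 # q0 # q1 # w \<approx> q1 # q0 # q1 # q1 # q1 # w"
  using eqv_relator[of "[q0, q0, q0]" "[q0, q0]" w] eqv_relator[of "[q0, q0, q1]" "[q0, q0]" w]
    eqv_relator[of "[q1, q0, q0]" "[q0, q0]" w] eqv_relator[of "[q0, q1, q0]" "[q0]" w]
    eqv_relator[of "[q0, q1, q1, q0]" "[q0, q0]" w]
    eqv_relator[of "[q1, q1, q1, q0, q1]" "[q1, q0, q1, q1, q1]" w]
  by (simp_all add: relators_def)

lemma act_eqv:
  assumes "u \<approx> v"
  shows "act u = act v"
  using assms generated_congruence_sound[where h = act and mult = "(\<circ>)", OF _ relators_free act_relators]
  by (auto simp: eqv_def)

lemma q0_q0_absorbs: "q0 # q0 # w \<approx> [q0, q0]"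
proof (induction w)
  case (Cons q w)
  have "q0 # q0 # q # w \<approx> q0 # q0 # w"
    by (cases q) (auto intro: eqv_relators)
  with Cons show ?case by (blast intro: eqv_trans)
qed simp

abbreviation ones :: "nat \<Rightarrow> state list" where "ones n \<equiv> replicate n q1"

text \<open>The last relator carries \<open>q1\<close> across \<open>q0\<close> two at a time. The
  tail \<open>w\<close> is arbitrary because the induction hypothesis is applied to
  \<open>q1 # q1 # w\<close>.\<close>

lemma ones_commute: "q1 # q0 # ones (2 * m + 1) @ w \<approx> ones (2 * m + 1) @ q0 # q1 # w"
proof (induction m arbitrary: w)
  case (Suc m)
  have "q1 # q0 # ones (2 * Suc m + 1) @ w = q1 # q0 # ones (2 * m + 1) @ q1 # q1 # w"
    by (simp add: replicate_app_Cons_same)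
  also have "\<dots> \<approx> ones (2 * m + 1) @ q0 # q1 # q1 # q1 # w"
    by (rule Suc)
  also have "\<dots> = ones (2 * m) @ q1 # q0 # q1 # q1 # q1 # w"
    by (simp add: replicate_app_Cons_same)
  also have "\<dots> \<approx> ones (2 * m) @ q1 # q1 # q1 # q0 # q1 # w"
    by (intro eqv_append_left eqv_sym[OF eqv_relators(6)])
  also have "\<dots> = ones (2 * Suc m + 1) @ q0 # q1 # w"
    by (simp add: replicate_app_Cons_same)
  finally show ?case .
qed simp

lemma ones_odd_q0: "q1 # q0 # ones (2 * m + 1) @ [q0] \<approx> ones (2 * m + 1) @ [q0]"
  by (rule eqv_trans[OF ones_commute]) (intro eqv_append_left eqv_relators)

text \<open>Reading \<open>ones_odd_q0\<close> backwards inserts \<open>q1 q0\<close> and so creates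
  the factor \<open>q0 q1 q1 q0\<close>, which is zero.\<close>

lemma ones_even_q0: "q0 # ones (2 * m) @ [q0] \<approx> [q0, q0]"
proof (cases m)
  case (Suc k)
  have "q0 # ones (2 * m) @ [q0] = [q0, q1] @ ones (2 * k + 1) @ [q0]"
    by (simp add: Suc)
  also have "\<dots> \<approx> [q0, q1] @ q1 # q0 # ones (2 * k + 1) @ [q0]"
    by (intro eqv_append_left eqv_sym[OF ones_odd_q0])
  also have "\<dots> \<approx> q0 # q0 # ones (2 * k + 1) @ [q0]"
    using eqv_relators(5) by simp
  also have "\<dots> \<approx> [q0, q0]"
    by (rule q0_q0_absorbs)
  finally show ?thesis .
qed simp

section \<open>Normal forms\<close>

text \<open>\<open>Z\<close> is the zero and \<open>P n\<close> the power \<open>f\<^sub>1\<^sup>n\<close>. The element \<open>N s e\<close> comes from a nonzero word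
  containing \<open>f\<^sub>0\<close>: the length of its trailing block of \<open>f\<^sub>1\<close> is zero, odd, or even and positive
  according to \<open>e\<close>, and \<open>s\<close> is the image of \<open>x\<^sub>1x\<^sub>1\<dots>\<close> (if \<open>e = Odd\<close>) or of
  \<open>x\<^sub>0x\<^sub>0\<dots>\<close> (otherwise), where \<open>Ones m\<close>, \<open>Zeros m\<close>, \<open>Three m\<close> stand for
  \<open>x\<^sub>2\<^sup>m\<close> followed by \<open>x\<^sub>1x\<^sub>1\<dots>\<close>, \<open>x\<^sub>0x\<^sub>0\<dots>\<close>, \<open>x\<^sub>3x\<^sub>1x\<^sub>1\<dots>\<close>.
  On the other one of these two words the value is \<open>x\<^sub>2x\<^sub>2\<dots>\<close>.\<close>

datatype pat = Ones nat | Zeros nat | Three nat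
datatype ending = Empty | Odd | Even
datatype elt = Z | P nat | N pat ending

fun step1 :: "pat \<Rightarrow> pat" where
  "step1 (Ones m) = Zeros m"
| "step1 (Zeros m) = Three m"
| "step1 (Three m) = Zeros (Suc m)"

text \<open>The clauses follow the generators on patterns: \<open>f0\<close> turns
  \<open>Zeros m\<close> into \<open>Ones m\<close> and the other patterns into twos. For
  \<open>P n\<close>, the index \<open>n div 2\<close> counts the letters \<open>x2\<close> that the
  \<open>n\<close>-th power of \<open>f1\<close> produces on the word selected by the
  ending.\<close>

fun left :: "state \<Rightarrow> elt \<Rightarrow> elt" where
  "left q Z = Z"
| "left q1 (P n) = P (Suc n)"
| "left q0 (P n) = N (Ones (n div 2)) (if n = 0 then Empty else if odd n then Odd else Even)"
| "left q1 (N s e) = N (step1 s) e"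
| "left q0 (N (Zeros m) e) = N (Ones m) e"
| "left q0 (N s e) = Z"

definition val :: "state list \<Rightarrow> elt" where
  "val w = foldr left w (P 0)"

lemma val_simps [simp]: "val [] = P 0" "val (q # w) = left q (val w)"
  by (simp_all add: val_def)

fun prefix :: "pat \<Rightarrow> state list" where
  "prefix (Ones m) = [q0]" | "prefix (Zeros m) = [q1, q0]" | "prefix (Three m) = [q1, q1, q0]"

fun index :: "pat \<Rightarrow> nat" where
  "index (Ones m) = m" | "index (Zeros m) = m" | "index (Three m) = m"

text \<open>For \<open>Empty\<close> the prefixes of \<open>Zeros\<close> and \<open>Three\<close>
  collapse by \<open>ones_odd_q0\<close>, hence the separate clauses; at \<open>Ones 0\<close> the
  word \<open>q0 q1 q0\<close> shortens to \<open>q0\<close>.\<close>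

fun rep :: "elt \<Rightarrow> state list" where
  "rep Z = [q0, q0]"
| "rep (P n) = ones n"
| "rep (N s Odd) = prefix s @ ones (2 * index s + 1)"
| "rep (N s Even) = prefix s @ ones (2 * index s)"
| "rep (N (Ones m) Empty) = (if m = 0 then [q0] else q0 # ones (2 * m + 1) @ [q0])"
| "rep (N (Zeros m) Empty) = ones (2 * m + 1) @ [q0]"
| "rep (N (Three m) Empty) = ones (2 * m + 2) @ [q0]"

text \<open>\<open>Even\<close> means a nonempty trailing block, and \<open>rep\<close> gives that
  block length \<open>2 * index s\<close>.\<close>

fun reduced :: "elt \<Rightarrow> bool" where
  "reduced (N s Even) \<longleftrightarrow> index s > 0"
| "reduced _ \<longleftrightarrow> True"

lemma reduced_left: "reduced a \<Longrightarrow> reduced (left q a)"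
proof (cases a)
  case (N s e)
  assume "reduced a"
  with N show ?thesis by (cases q; cases s; cases e) auto
qed (cases q; auto elim!: evenE)+

lemma reduced_val: "reduced (val w)"
  by (induction w) (simp_all add: reduced_left)

lemma left_rep:
  assumes "reduced a"
  shows "q # rep a \<approx> rep (left q a)"
proof (cases a)
  case Z
  then show ?thesis
    using eqv_relators(1,3)[of "[]"] by (cases q) auto
next
  case (P n)
  then show ?thesis
    by (cases q) (auto elim!: evenE oddE)
next
  case (N s e)
  show ?thesis
  \<comment> \<open>These products vanish: the new \<open>q0\<close> meets another
    \<open>q0\<close>, directly or across an even block of \<open>q1\<close>.\<close>
  proof (cases "q = q0 \<and> (\<forall>m. s \<noteq> Zeros m)")
    case True
    then show ?thesis
      using N q0_q0_absorbs ones_even_q0[of "Suc (index s)"] eqv_trans[OF eqv_relators(5) q0_q0_absorbs]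
      by (cases s; cases e) auto
  next
    case False
    show ?thesis
    proof (cases e)
      case Empty
      then show ?thesis
        using N False eqv_relators(4)[of "[]"] ones_odd_q0[of "index s"]
        by (cases q; cases s) auto
    next
      case Odd
      then show ?thesis
        using N False eqv_relators(4,6) by (cases q; cases s) auto
    next
      case Even
      \<comment> \<open>Moving \<open>q1 q1\<close> across \<open>q0\<close> uses a
        \<open>q1\<close> already standing behind it, so the block must be nonempty.\<close>
      then have "index s > 0" using N assms by simp
      then obtain k where "index s = Suc k" using gr0_implies_Suc by blast
      then show ?thesis
        using N False Even eqv_relators(4,6) by (cases q; cases s) auto
    qed
  qed
qed

lemma eqv_rep_val: "w \<approx> rep (val w)"
proof (induction w)
  case (Cons q w)
  then have "q # w \<approx> q # rep (val w)" by (rule eqv_Cons)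
  also have "\<dots> \<approx> rep (val (q # w))" by (simp add: left_rep reduced_val)
  finally show ?case .
qed simp

section \<open>Separation of the normal forms\<close>

fun pattern :: "pat \<Rightarrow> nat \<Rightarrow> letter list" where
  "pattern s 0 = []"
| "pattern (Ones 0) (Suc k) = x1 # pattern (Ones 0) k"
| "pattern (Zeros 0) (Suc k) = x0 # pattern (Zeros 0) k"
| "pattern (Three 0) (Suc k) = x3 # pattern (Ones 0) k"
| "pattern (Ones (Suc m)) (Suc k) = x2 # pattern (Ones m) k"
| "pattern (Zeros (Suc m)) (Suc k) = x2 # pattern (Zeros m) k"
| "pattern (Three (Suc m)) (Suc k) = x2 # pattern (Three m) k"

fun opattern :: "pat option \<Rightarrow> nat \<Rightarrow> letter list" where
  "opattern None k = replicate k x2"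
| "opattern (Some s) k = pattern s k"

lemma f0_Zeros [simp]: "f0 (pattern (Zeros m) k) = pattern (Ones m) k"
  by (induction "Zeros m" k arbitrary: m rule: pattern.induct) simp_all

lemma f0_Ones [simp]: "f0 (pattern (Ones m) k) = replicate k x2"
  by (induction "Ones m" k arbitrary: m rule: pattern.induct) simp_all

lemma f0_Three [simp]: "f0 (pattern (Three m) k) = replicate k x2"
  by (induction "Three m" k arbitrary: m rule: pattern.induct) simp_all

lemma f1_Ones [simp]: "f1 (pattern (Ones m) k) = pattern (Zeros m) k"
  by (induction "Ones m" k arbitrary: m rule: pattern.induct) simp_all

lemma f1_Zeros [simp]: "f1 (pattern (Zeros m) k) = pattern (Three m) k"
  by (induction "Zeros m" k arbitrary: m rule: pattern.induct) simp_all

lemma f1_Three [simp]: "f1 (pattern (Three m) k) = pattern (Zeros (Suc m)) k"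
  by (induction "Three m" k arbitrary: m rule: pattern.induct) simp_all

text \<open>The image of \<open>Ones 0\<close> under the \<open>n\<close>-th power of
  \<open>f1\<close>.\<close>

fun power_pat :: "nat \<Rightarrow> pat" where
  "power_pat 0 = Ones 0"
| "power_pat (Suc n) = step1 (power_pat n)"

fun on_ones :: "elt \<Rightarrow> pat option" where
  "on_ones Z = None"
| "on_ones (P n) = Some (power_pat n)"
| "on_ones (N s e) = (if e = Odd then Some s else None)"

text \<open>\<open>Suc n\<close> appears because \<open>Zeros 0\<close> is itself the image of
  \<open>Ones 0\<close> under \<open>f1\<close>.\<close>

fun on_zeros :: "elt \<Rightarrow> pat option" where
  "on_zeros Z = None"
| "on_zeros (P n) = Some (power_pat (Suc n))"
| "on_zeros (N s e) = (if e = Odd then None else Some s)"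

lemma power_pat_even_odd:
  "power_pat (2 * n + 1) = Zeros n" "power_pat (2 * n + 2) = Three n"
  by (induction n) simp_all

lemma power_pat_cases:
  obtains "n = 0" "power_pat n = Ones 0"
  | m where "n = 2 * m + 1" "power_pat n = Zeros m"
  | m where "n = 2 * m + 2" "power_pat n = Three m"
proof (cases "odd n")
  case True
  then show ?thesis using that(2) power_pat_even_odd(1) by (auto elim!: oddE)
next
  case False
  then obtain m where n: "n = 2 * m" by (auto elim: evenE)
  show ?thesis
  proof (cases m)
    case 0
    then show ?thesis using that(1) n by simp
  next
    case (Suc k)
    then show ?thesis using that(3)[of k] n power_pat_even_odd(2)[of k] by simp
  qed
qed

lemma inj_power_pat: "power_pat m = power_pat n \<Longrightarrow> m = n"
  by (cases m rule: power_pat_cases; cases n rule: power_pat_cases) auto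


lemma act_on_ones: "act w (pattern (Ones 0) k) = opattern (on_ones (val w)) k"
proof (induction w)
  case (Cons q w)
  show ?case
  proof (cases "val w")
    case (P n)
    then show ?thesis
      using Cons by (cases n rule: power_pat_cases; cases q) auto
  next
    case (N s e)
    then show ?thesis
      using Cons by (cases s; cases q) auto
  qed (use Cons in \<open>cases q; simp\<close>)
qed simp

lemma act_on_zeros: "act w (pattern (Zeros 0) k) = opattern (on_zeros (val w)) k"
proof (induction w)
  case (Cons q w)
  show ?case
  proof (cases "val w")
    case (P n)
    then show ?thesis
      using Cons by (cases n rule: power_pat_cases; cases q) auto
  next
    case (N s e)
    then show ?thesis
      using Cons by (cases s; cases q) auto
  qed (use Cons in \<open>cases q; simp\<close>)
qed simp

text \<open>The word \<open>x1\<close> followed by zeros tells \<open>Empty\<close> from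
  \<open>Even\<close>: an initial \<open>f0\<close> makes the first letter \<open>x2\<close>, which
  changes no state, whereas a second \<open>f1\<close> reads \<open>x0\<close> first, passes to
  \<open>q0\<close> and sends the tail to twos.\<close>

fun on_one_zeros :: "elt \<Rightarrow> pat option" where
  "on_one_zeros Z = None"
| "on_one_zeros (P n) = (if n = 0 then Some (Zeros 0) else if n = 1 then Some (Three 0) else None)"
| "on_one_zeros (N s e) = (if e = Empty then Some s else None)"

text \<open>The first letter matters only while the tail is not yet twos; afterwards every state
  preserves the tail, so \<open>UNIV\<close> suffices.\<close>

fun head_on_one_zeros :: "elt \<Rightarrow> letter set" where
  "head_on_one_zeros (P n) = (if n = 0 then {x1} else if n = 1 then {x0} else UNIV)"
| "head_on_one_zeros (N s e) = (if e = Empty then {x2} else UNIV)"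
| "head_on_one_zeros Z = UNIV"

lemma transf_Cons_twos: "\<exists>y. transf A3 q (x # replicate k x2) = y # replicate k x2"
  by (cases q; cases x) simp_all

lemma act_on_one_zeros:
  "\<exists>x\<in>head_on_one_zeros (val w). act w (x1 # pattern (Zeros 0) k) = x # opattern (on_one_zeros (val w)) k"
proof (induction w)
  case (Cons q w)
  then obtain x where x: "x \<in> head_on_one_zeros (val w)"
    "act w (x1 # pattern (Zeros 0) k) = x # opattern (on_one_zeros (val w)) k" by blast
  show ?case
  proof (cases "val w")
    case Z
    then show ?thesis
      using x transf_Cons_twos[of q x k] by simp
  next
    case (P n)
    consider "n = 0" | "n = 1" | "n \<ge> 2" by linarith
    then show ?thesis
      using x transf_Cons_twos[of q x k] P by cases (cases q; auto)+
  next
    case (N s e)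
    then show ?thesis
      using x transf_Cons_twos[of q x k] by (cases "e = Empty"; cases q; cases s) auto
  qed
qed simp

fun letter_at :: "pat option \<Rightarrow> nat \<Rightarrow> letter" where
  "letter_at None i = x2"
| "letter_at (Some (Ones m)) i = (if i < m then x2 else x1)"
| "letter_at (Some (Zeros m)) i = (if i < m then x2 else x0)"
| "letter_at (Some (Three m)) i = (if i < m then x2 else if i = m then x3 else x1)"

lemma pattern_nth: "i < k \<Longrightarrow> pattern s k ! i = letter_at (Some s) i"
  by (induction s k arbitrary: i rule: pattern.induct) (auto simp: nth_Cons' split: if_splits)

lemma opattern_nth: "i < k \<Longrightarrow> opattern a k ! i = letter_at a i"
  by (cases a) (simp_all add: pattern_nth del: letter_at.simps(2-))

lemma opattern_inject:
  assumes "\<And>k. opattern a k = opattern b k"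
  shows "a = b"
proof -
  have eq: "letter_at a i = letter_at b i" for i
    using assms[of "Suc i"] opattern_nth[of i "Suc i"] by (metis lessI)
  \<comment> \<open>The index is the first position whose letter is not \<open>x2\<close>; the
    letter there, \<open>x1\<close>, \<open>x0\<close> or \<open>x3\<close>, identifies the
    constructor.\<close>
  have at_index: "letter_at (Some s) i = x2 \<longleftrightarrow> i < index s" for s i
    by (cases s) auto
  show ?thesis
  proof (cases a)
    case None
    then show ?thesis
      using eq at_index by (cases b) (simp, metis letter_at.simps(1) less_irrefl)
  next
    case a: (Some s)
    show ?thesis
    proof (cases b)
      case None
      then show ?thesis
        using eq at_index a by (metis letter_at.simps(1) less_irrefl)
    next
      case b: (Some t)
      have "i < index s \<longleftrightarrow> i < index t" for i
        using eq[of i] a b at_index by metis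
      then have "index s = index t"
        by (metis linorder_neq_iff less_irrefl)
      then show ?thesis
        using eq[of "index s"] a b by (cases s; cases t) auto
    qed
  qed
qed

text \<open>On the first two test words \<open>P\<close> yields a pattern twice, \<open>Z\<close>
  never, and \<open>N\<close> exactly once, which detects \<open>Odd\<close>; the third word
  separates \<open>Empty\<close> from \<open>Even\<close>.\<close>

lemma elt_eqI:
  assumes "on_ones a = on_ones b" "on_zeros a = on_zeros b" "on_one_zeros a = on_one_zeros b"
  shows "a = b"
proof (cases a; cases b)
  fix s e t f assume "a = N s e" "b = N t f"
  with assms show ?thesis
    by (cases e; cases f) auto
qed (use assms in \<open>auto simp: inj_power_pat split: if_splits\<close>)

lemma act_eq_iff: "act v = act w \<longleftrightarrow> val v = val w"
proof
  assume eq: "act v = act w"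
  show "val v = val w"
  proof (rule elt_eqI; rule opattern_inject)
    fix k
    show "opattern (on_ones (val v)) k = opattern (on_ones (val w)) k"
      using act_on_ones[of v k] act_on_ones[of w k] eq by simp
    show "opattern (on_zeros (val v)) k = opattern (on_zeros (val w)) k"
      using act_on_zeros[of v k] act_on_zeros[of w k] eq by simp
    show "opattern (on_one_zeros (val v)) k = opattern (on_one_zeros (val w)) k"
      using act_on_one_zeros[of v k] act_on_one_zeros[of w k] eq by auto
  qed
next
  assume "val v = val w"
  then have "v \<approx> w"
    using eqv_rep_val eqv_sym eqv_trans by metis
  then show "act v = act w" by (rule act_eqv)
qed

lemma act_eq_imp_eqv: "act v = act w \<Longrightarrow> v \<approx> w"
  using eqv_rep_val eqv_sym eqv_trans act_eq_iff by metis

section \<open>Growth\<close>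

definition vals :: "nat \<Rightarrow> elt set" where
  "vals n = val ` {w. length w = n}"

lemma growth_eq_card_vals: "growth A3 n = card (vals n)"
proof -
  have "{w. set w \<subseteq> states A3 \<and> length w = n} = {w. length w = n}"
    using state.exhaust by (auto simp: A3_def)
  then have "growth A3 n = card (act ` {w. length w = n})"
    by (simp add: growth_eq_card_products act_def)
  moreover have "bij_betw (\<lambda>a. act (rep a)) (vals n) (act ` {w. length w = n})"
    unfolding bij_betw_def
  proof
    have rep: "act (rep (val w)) = act w" for w
      using act_eqv[OF eqv_rep_val] by simp
    then show "(\<lambda>a. act (rep a)) ` vals n = act ` {w. length w = n}"
      by (simp add: vals_def image_image)
    show "inj_on (\<lambda>a. act (rep a)) (vals n)"
      by (auto simp: inj_on_def vals_def rep simp flip: act_eq_iff)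
  qed
  ultimately show ?thesis
    using bij_betw_same_card by metis
qed

lemma vals_0: "vals 0 = {P 0}"
  by (simp add: vals_def)

lemma vals_Suc: "vals (Suc n) = left q0 ` vals n \<union> left q1 ` vals n"
proof -
  have "{w. length w = Suc n} = Cons q0 ` {w. length w = n} \<union> Cons q1 ` {w. length w = n}"
    using state.exhaust by (auto simp: length_Suc_conv)
  then show ?thesis
    by (simp add: vals_def image_Un image_image)
qed

text \<open>The \<open>N\<close>-forms listed are those whose \<open>rep\<close> has even length at
  most \<open>2 * j\<close>: relators without \<open>q0 q0\<close> preserve the parity of the
  length, and \<open>q0 q1 q0 = q0\<close> read backwards lengthens a word by two.\<close>

definition even_vals :: "nat \<Rightarrow> elt set" where
  "even_vals j = {Z, P (2 * j)} \<union>
     ((\<lambda>m. N (Ones m) Odd) ` {..<j} \<union> (\<lambda>m. N (Three m) Odd) ` {..<j - 1} \<union>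
      (\<lambda>m. N (Zeros m) Empty) ` {..<j} \<union> (\<lambda>m. N (Zeros m) Even) ` {1..<j})"

text \<open>Likewise for odd lengths up to \<open>2 * j + 1\<close>; \<open>Ones j\<close> with
  \<open>Even\<close> is included, as \<open>q0\<close> followed by \<open>2 * j\<close> letters
  \<open>q1\<close> has exactly this length.\<close>

definition odd_vals :: "nat \<Rightarrow> elt set" where
  "odd_vals j = {Z, P (2 * j + 1)} \<union>
     ((\<lambda>m. N (Zeros m) Odd) ` {..<j} \<union> (\<lambda>m. N (Ones m) Empty) ` {..<j} \<union>
      (\<lambda>m. N (Three m) Empty) ` {..<j} \<union> (\<lambda>m. N (Ones m) Even) ` {1..<Suc j} \<union>
      (\<lambda>m. N (Three m) Even) ` {1..<j})"

lemma vals_even_odd: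
  assumes "j \<ge> 1"
  shows "left q0 ` even_vals j \<union> left q1 ` even_vals j = odd_vals j"
  unfolding even_vals_def odd_vals_def image_Un image_insert image_empty image_image
  using assms by (auto simp: image_iff atLeastLessThanSuc)

lemma vals_odd_even:
  assumes "j \<ge> 1"
  shows "left q0 ` odd_vals j \<union> left q1 ` odd_vals j = even_vals (Suc j)"
  unfolding even_vals_def odd_vals_def image_Un image_insert image_empty image_image
  using assms
  by (auto simp: image_iff atLeastLessThanSuc)
    (metis One_nat_def Suc_le_eq lessThan_iff less_Suc_eq_0_disj)+

lemma card_even_vals: "j \<ge> 1 \<Longrightarrow> card (even_vals j) = 4 * j"
  unfolding even_vals_def
  \<comment> \<open>The families differ in constructor or ending, so the sizes add up to
    \<open>2 + j + (j - 1) + j + (j - 1)\<close>.\<close>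
  by (subst card_Un_disjoint; (auto; fail)?)+ (auto simp: card_image inj_on_def)

lemma card_odd_vals: "j \<ge> 1 \<Longrightarrow> card (odd_vals j) = 5 * j + 1"
  unfolding odd_vals_def
  by (subst card_Un_disjoint; (auto; fail)?)+ (auto simp: card_image inj_on_def)

text \<open>The alternating induction starts at length 2, since \<open>even_vals 0\<close> contains
  \<open>Z\<close> but \<open>vals 0\<close> does not.\<close>

lemma vals_eq:
  assumes "j \<ge> 1"
  shows "vals (2 * j) = even_vals j" "vals (2 * j + 1) = odd_vals j"
proof -
  show even: "vals (2 * j) = even_vals j"
    using assms
  proof (induction j rule: nat_induct_at_least)
    case base
    have "vals (2 * 1) = {Z, P 2, N (Ones 0) Odd, N (Zeros 0) Empty}"
      by (simp add: numeral_2_eq_2 vals_Suc vals_0) auto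
    also have "\<dots> = even_vals 1"
      by (auto simp: even_vals_def)
    finally show ?case .
  next
    case (Suc j)
    then show ?case
      by (simp add: vals_Suc vals_even_odd vals_odd_even)
  qed
  show "vals (2 * j + 1) = odd_vals j"
    using assms by (simp add: vals_Suc even vals_even_odd)
qed

lemma growth_values:
  assumes "n \<ge> 1"
  shows "growth A3 (2 * n) = 4 * n" "growth A3 (2 * n + 1) = 5 * n + 1"
  using assms by (simp_all only: growth_eq_card_vals vals_eq card_even_vals card_odd_vals)

lemma composite_growth: "composite_function 2 (growth A3)"
  unfolding composite_function_def
proof (intro conjI exI)
  show "\<not> (\<forall>\<^sub>F n in sequentially. growth A3 (2 * n + 0) = growth A3 (2 * n + 1))"
  proof
    assume "\<forall>\<^sub>F n in sequentially. growth A3 (2 * n + 0) = growth A3 (2 * n + 1)"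
    then obtain k where "\<And>n. n \<ge> k \<Longrightarrow> growth A3 (2 * n + 0) = growth A3 (2 * n + 1)"
      by (auto simp: eventually_sequentially)
    \<comment> \<open>The argument \<open>Suc k\<close> is both beyond the threshold and at least 1,
      where \<open>4 * n\<close> and \<open>5 * n + 1\<close> differ.\<close>
    from this[of "Suc k"] show False
      using growth_values[of "Suc k"] by simp
  qed
qed simp_all

theorem theorem4p2:
  shows "has_semigroup_presentation (automaton_semigroup A3) (\<circ>) {q0, q1} (transf A3)
           {([q0, q0, q0], [q0, q0]),
            ([q0, q0, q1], [q0, q0]),
            ([q1, q0, q0], [q0, q0]),
            ([q0, q1, q0], [q0]),
            ([q0, q1, q1, q0], [q0, q0]),
            ([q1, q1, q1, q0, q1], [q1, q0, q1, q1, q1])}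
       \<and> composite_function 2 (growth A3)
       \<and> (\<forall>n\<ge>1. growth A3 (2 * n) = 4 * n \<and> growth A3 (2 * n + 1) = 5 * n + 1)
       \<and> growth A3 1 = 2"
proof (intro conjI allI impI)
  have "has_semigroup_presentation (automaton_semigroup A3) (\<circ>) {q0, q1} (transf A3) relators"
  proof (rule has_semigroup_presentationI[where h = act])
    have "states A3 = {q0, q1}" by (simp add: A3_def)
    then show "act ` free_semigroup {q0, q1} = automaton_semigroup A3"
      using products_eq_automaton_semigroup[of A3] by (simp add: act_def)
    show "(u, v) \<in> generated_congruence {q0, q1} relators"
      if "u \<in> free_semigroup {q0, q1}" "v \<in> free_semigroup {q0, q1}" "act u = act v" for u v
    proof -
      \<comment> \<open>Covers the case in which \<open>eqv\<close> holds by mere equality.\<close>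
      have "(u, u) \<in> generated_congruence {q0, q1} relators"
        using congruence that(1) by (simp add: free_congruence_def equiv_def refl_on_def)
      then show ?thesis
        using act_eq_imp_eqv[OF that(3)] by (auto simp: eqv_def)
    qed
  qed (auto simp: relators_free act_relators fun_eq_iff)
  then show "has_semigroup_presentation (automaton_semigroup A3) (\<circ>) {q0, q1} (transf A3)
           {([q0, q0, q0], [q0, q0]),
            ([q0, q0, q1], [q0, q0]),
            ([q1, q0, q0], [q0, q0]),
            ([q0, q1, q0], [q0]),
            ([q0, q1, q1, q0], [q0, q0]),
            ([q1, q1, q1, q0, q1], [q1, q0, q1, q1, q1])}"
    by (simp only: relators_def)
  show "growth A3 1 = 2"
    by (simp add: growth_eq_card_vals vals_Suc vals_0)
qed (use composite_growth growth_values in auto)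

end
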